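(* Let $(R,\mathfrak m)$ be a Noetherian local domain, and let $\mathfrak a_\bullet=\{\mathfrak a_p\}_{p\ge1}$ and $\mathfrak b_\bullet=\{\mathfrak b_q\}_{q\ge1}$ be graded families of ideals in $R$. Then $$\mathcal L_{\mathfrak b_\bullet}(\mathfrak a_\bullet)\ \ge\ \sup_v\ \frac{v(\mathfrak a_\bullet)}{v(\mathfrak b_\bullet)},$$ where the supremum is taken over all valuations $v$ centered at $\mathfrak m$ with $v(\mathfrak b_\bullet)>0$.
   Context: Ideals are always proper. A graded family of ideals $\{\mathfrak a_p\}_{p\ge1}$ satisfies $\mathfrak a_p\mathfrak a_{p'}\subseteq\mathfrak a_{p+p'}$ for all $p,p'\ge1$. Algebraic Łojasiewicz exponent: $\mathcal L_{\mathfrak b_\bullet}(\mathfrak a_\bullet):=\inf\{\frac qp\in\mathbb Q_{>0}:\ \mathfrak b_{qt}\subseteq\overline{\mathfrak a_{pt}}\text{ for all integers }t\gg1\}\in\mathbb R_{\ge0}\cup\{\infty\}$, with $\inf\emptyset=\infty$, where $\overline I$ is the integral closure of $I$. A valuation on $R$ is a map $v:R\setminus\{0\}\to\mathbb R_{\ge0}$ with $v(xy)=v(x)+v(y)$ and $v(x+y)\ge\min\{v(x),v(y)\}$, extended by $v(0)=\infty$; it is centered at $\mathfrak m$ if $v(x)>0$ for all $x\in\mathfrak m$. For an ideal $I$, $v(I):=\min\{v(x):x\in I\}$. For a graded family, $v(\mathfrak a_\bullet):=\lim_{p\to\infty}\frac{v(\mathfrak a_p)}p=\inf_{p\ge1}\frac{v(\mathfrak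 a_p)}p$. *)

theory Defs
  imports
    "HOL-Algebra.Ring_Divisibility"
    "HOL-Algebra.Ideal_Product"
    "HOL-Library.Extended_Nonnegative_Real"
begin

locale noetherian_local_domain = noetherian_domain R + maximalideal \<mm> R
  for R (structure) and \<mm> +
  assumes unique_maximal: "maximalideal J R \<Longrightarrow> J = \<mm>"

text \<open>Families are indexed by the positive integers: the value at index 0 is irrelevant.
  All members are proper ideals; the zero ideal is allowed.\<close>

definition graded_family :: "('a, 'b) ring_scheme \<Rightarrow> (nat \<Rightarrow> 'a set) \<Rightarrow> bool"
  where "graded_family R \<aa> \<longleftrightarrow>
    (\<forall>p\<ge>1. ideal (\<aa> p) R \<and> \<aa> p \<noteq> carrier R) \<and>
    (\<forall>p\<ge>1. \<forall>p'\<ge>1. \<aa> p \<cdot>\<^bsub>R\<^esub> \<aa> p' \<subseteq> \<aa> (p + p'))"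

text \<open>Elements satisfying an equation x^n + c_1 x^(n-1) + ... + c_n = 0 with n at least 1
  and c_i in I^i; powers of ideals are taken in the monoid of ideals of R.\<close>

definition integral_closure :: "('a, 'b) ring_scheme \<Rightarrow> 'a set \<Rightarrow> 'a set"
  where "integral_closure R I = {x \<in> carrier R.
    \<exists>n\<ge>1. \<exists>c. (\<forall>i\<in>{1..n}. c i \<in> I [^]\<^bsub>ideals_set R\<^esub> (i::nat)) \<and>
      x [^]\<^bsub>R\<^esub> n \<oplus>\<^bsub>R\<^esub> (\<Oplus>\<^bsub>R\<^esub>i\<in>{1..n}. c i \<otimes>\<^bsub>R\<^esub> x [^]\<^bsub>R\<^esub> (n - i)) = \<zero>\<^bsub>R\<^esub>}"

text \<open>The family occurring as a subscript in the usual notation comes first; the infimum is taken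
  in the extended half-line, so it is infinite if the set is empty.\<close>

definition lojasiewicz_exponent ::
    "('a, 'b) ring_scheme \<Rightarrow> (nat \<Rightarrow> 'a set) \<Rightarrow> (nat \<Rightarrow> 'a set) \<Rightarrow> ennreal"
  where "lojasiewicz_exponent R \<bb> \<aa> = Inf {ennreal (real q / real p) | p q.
    p \<ge> 1 \<and> q \<ge> 1 \<and>
    (\<forall>\<^sub>F t in sequentially. \<bb> (q * t) \<subseteq> integral_closure R (\<aa> (p * t)))}"

text \<open>Real-valued on nonzero elements and infinite at zero. Values outside the carrier are
  irrelevant.\<close>

locale valuation = domain R for R (structure) +
  fixes v :: "'a \<Rightarrow> ennreal"
  assumes val_zero: "v \<zero> = \<infinity>"
    and val_finite: "\<lbrakk>x \<in> carrier R; x \<noteq> \<zero>\<rbrakk> \<Longrightarrow> v x < \<infinity>"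
    and val_mult: "\<lbrakk>x \<in> carrier R; y \<in> carrier R\<rbrakk> \<Longrightarrow> v (x \<otimes> y) = v x + v y"
    and val_add: "\<lbrakk>x \<in> carrier R; y \<in> carrier R\<rbrakk> \<Longrightarrow> v (x \<oplus> y) \<ge> min (v x) (v y)"

definition centered_valuation :: "('a, 'b) ring_scheme \<Rightarrow> 'a set \<Rightarrow> ('a \<Rightarrow> ennreal) \<Rightarrow> bool"
  where "centered_valuation R \<mm> v \<longleftrightarrow> valuation R v \<and> (\<forall>x\<in>\<mm>. v x > 0)"

text \<open>The infimum is attained in a Noetherian ring, see \<open>ideal_value_attained\<close> below.\<close>

definition ideal_value :: "('a \<Rightarrow> ennreal) \<Rightarrow> 'a set \<Rightarrow> ennreal"
  where "ideal_value v I = (INF x\<in>I. v x)"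

text \<open>The infimum is the limit of v(a_p)/p if all a_p are nonzero, see
  \<open>asymptotic_value_limit\<close> below. If zero members are allowed the limit need not
  exist: take a_p zero exactly for odd p.\<close>

definition asymptotic_value :: "('a \<Rightarrow> ennreal) \<Rightarrow> (nat \<Rightarrow> 'a set) \<Rightarrow> ennreal"
  where "asymptotic_value v \<aa> = (INF p\<in>{1..}. ideal_value v (\<aa> p) / of_nat p)"

lemma (in valuation) val_one: "v \<one> = 0"
proof -
  have "v \<one> + v \<one> = v \<one> + 0" using val_mult[of \<one> \<one>] by simp
  then show ?thesis
    using val_finite[OF one_closed one_not_zero] by (auto simp: ennreal_add_left_cancel)
qed

lemma (in valuation) val_uminus:
  assumes x: "x \<in> carrier R" shows "v (\<ominus> x) = v x"
proof -
  have "v (\<ominus> \<one>) + v (\<ominus> \<one>) = 0"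
    using val_mult[of "\<ominus> \<one>" "\<ominus> \<one>"] val_one by (simp add: l_minus r_minus)
  then have "v (\<ominus> \<one>) = 0" by simp
  then show ?thesis using val_mult[of "\<ominus> \<one>" x] x by (simp add: l_minus)
qed

lemma (in valuation) ideal_val_ge: "ideal {x \<in> carrier R. c \<le> v x} R"
proof (rule idealI)
  show "ring R" by (rule ring_axioms)
  show "subgroup {x \<in> carrier R. c \<le> v x} (add_monoid R)"
  proof (rule subgroup.intro)
    fix x y assume *: "x \<in> {x \<in> carrier R. c \<le> v x}" "y \<in> {x \<in> carrier R. c \<le> v x}"
    then have "c \<le> min (v x) (v y)" by simp
    also have "\<dots> \<le> v (x \<oplus> y)" using * by (intro val_add) auto
    finally show "x \<otimes>\<^bsub>add_monoid R\<^esub> y \<in> {x \<in> carrier R. c \<le> v x}"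
      using * by simp
  next
    fix x assume "x \<in> {x \<in> carrier R. c \<le> v x}"
    then show "inv\<^bsub>add_monoid R\<^esub> x \<in> {x \<in> carrier R. c \<le> v x}"
      using val_uminus[of x] by (simp add: a_inv_def[symmetric])
  qed (auto simp: val_zero)
qed (auto simp: val_mult add_increasing add_increasing2)

lemma ideal_value_attained:
  assumes R: "noetherian_ring R" and v: "valuation R v" and I: "ideal I R"
  shows "\<exists>x\<in>I. v x = ideal_value v I"
proof -
  interpret valuation R v by fact
  obtain A where A: "A \<subseteq> carrier R" "finite A" "I = Idl\<^bsub>R\<^esub> A"
    using noetherian_ring.finetely_gen[OF R I] by blast
  define B where "B = insert \<zero>\<^bsub>R\<^esub> A"
  have B: "finite B" "B \<noteq> {}" "B \<subseteq> carrier R" using A by (auto simp: B_def)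
  have BI: "B \<subseteq> I"
    using genideal_self[OF A(1)] A(3) additive_subgroup.zero_closed[OF ideal.axioms(1)[OF I]]
    by (auto simp: B_def)
  define c where "c = Min (v ` B)"
  have "c \<in> v ` B" unfolding c_def using B by (intro Min_in) auto
  then obtain x where x: "x \<in> I" "v x = c" using BI by auto
  have "A \<subseteq> {x \<in> carrier R. c \<le> v x}"
    using A B by (auto simp: c_def B_def intro!: Min_le)
  then have "I \<subseteq> {x \<in> carrier R. c \<le> v x}"
    unfolding A(3) by (rule genideal_minimal[OF ideal_val_ge])
  then have "c \<le> ideal_value v I"
    unfolding ideal_value_def by (intro INF_greatest) auto
  moreover have "ideal_value v I \<le> c"
    unfolding ideal_value_def using x by (metis INF_lower)
  ultimately show ?thesis using x by (metis antisym)
qed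

lemma subadditive_limit:
  fixes u :: "nat \<Rightarrow> real"
  assumes nonneg: "\<And>n. u n \<ge> 0"
    and sub: "\<And>m n. m \<ge> 1 \<Longrightarrow> n \<ge> 1 \<Longrightarrow> u (m + n) \<le> u m + u n"
  shows "(\<lambda>n. u n / real n) \<longlonglongrightarrow> (INF n\<in>{1..}. u n / real n)"
proof (rule LIMSEQ_I)
  define L where "L = (INF n\<in>{1..}. u n / real n)"
  have bdd: "bdd_below ((\<lambda>n. u n / real n) ` {1..})"
    by (rule bdd_belowI[of _ 0]) (auto simp: nonneg)
  fix e :: real assume e: "0 < e"
  have "\<exists>m\<in>{1..}. u m / real m < L + e / 2"
    using e bdd by (subst cINF_less_iff[symmetric]) (auto simp: L_def)
  then obtain m where m: "m \<ge> 1" "u m / real m < L + e / 2" by auto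
  define C where "C = Max (u ` {1..m})"
  have C: "u r \<le> C" if "1 \<le> r" "r \<le> m" for r
    unfolding C_def using that by (intro Max_ge) auto
  have C0: "C \<ge> 0" using C[of 1] m nonneg[of 1] by linarith
  have step: "u (k * m + r) \<le> real k * u m + u r" if "1 \<le> r" for k r
  proof (induction k)
    case (Suc k)
    have "u (m + (k * m + r)) \<le> u m + u (k * m + r)" using m that by (intro sub) auto
    with Suc show ?case by (simp add: algebra_simps)
  qed simp
  obtain N where N: "real N > 2 * C / e" using reals_Archimedean2 by blast
  show "\<exists>no. \<forall>n\<ge>no. norm (u n / real n - (INF n\<in>{1..}. u n / real n)) < e"
  proof (intro exI[of _ "max 1 N"] allI impI)
    fix n assume n: "n \<ge> max 1 N"
    define k where "k = (n - 1) div m"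
    define r where "r = (n - 1) mod m + 1"
    have nk: "n = k * m + r" using n by (simp add: k_def r_def)
    have r: "1 \<le> r" "r \<le> m" using m by (auto simp: r_def Suc_le_eq)
    have "u n \<le> real k * u m + C" using step[OF r(1), of k] C[OF r] nk by simp
    moreover have "real k * u m \<le> real n * (u m / real m)"
    proof -
      have "real k * u m = real (k * m) * (u m / real m)" using m by simp
      also have "\<dots> \<le> real n * (u m / real m)"
        using nk nonneg[of m] by (intro mult_right_mono) (auto simp del: of_nat_mult)
      finally show ?thesis .
    qed
    ultimately have "u n \<le> real n * (u m / real m) + C" by simp
    then have "u n / real n \<le> (real n * (u m / real m) + C) / real n"
      by (rule divide_right_mono) simp
    also have "\<dots> = u m / real m + C / real n" using n by (simp add: add_divide_distrib)
    also have "C / real n < e / 2"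
    proof -
      have "2 * C / e < real n" using N n by linarith
      then show ?thesis using e n by (simp add: field_simps)
    qed
    finally have "u n / real n < L + e" using m by simp
    moreover have "L \<le> u n / real n"
      unfolding L_def using bdd n by (intro cINF_lower) auto
    ultimately show "norm (u n / real n - (INF n\<in>{1..}. u n / real n)) < e"
      using e unfolding L_def[symmetric] by simp
  qed
qed

lemma asymptotic_value_limit:
  assumes R: "noetherian_ring R" and v: "valuation R v" and \<aa>: "graded_family R \<aa>"
    and nz: "\<And>p. p \<ge> 1 \<Longrightarrow> \<aa> p \<noteq> {\<zero>\<^bsub>R\<^esub>}"
  shows "(\<lambda>p. ideal_value v (\<aa> p) / of_nat p) \<longlonglongrightarrow> asymptotic_value v \<aa>"
proof -
  interpret valuation R v by fact
  define w where "w p = ideal_value v (\<aa> p)" for p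
  define u where "u p = enn2real (w p)" for p
  have id: "ideal (\<aa> p) R" if "p \<ge> 1" for p using \<aa> that by (simp add: graded_family_def)
  have fin: "w p < \<infinity>" if p: "p \<ge> 1" for p
  proof -
    obtain x where "x \<in> \<aa> p" "x \<noteq> \<zero>\<^bsub>R\<^esub>"
      using nz[OF p] additive_subgroup.zero_closed[OF ideal.axioms(1)[OF id[OF p]]] by blast
    moreover from this have "v x < \<infinity>" using ideal.Icarr[OF id[OF p]] val_finite by auto
    ultimately show ?thesis unfolding w_def ideal_value_def by (auto simp: INF_less_iff)
  qed
  have wu: "w p = ennreal (u p)" if "p \<ge> 1" for p using fin[OF that] by (simp add: u_def)
  have sub: "w (p + p') \<le> w p + w p'" if p: "p \<ge> 1" "p' \<ge> 1" for p p'
  proof -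
    obtain x y where xy: "x \<in> \<aa> p" "v x = w p" "y \<in> \<aa> p'" "v y = w p'"
      using ideal_value_attained[OF R v id[OF p(1)]] ideal_value_attained[OF R v id[OF p(2)]]
      unfolding w_def by blast
    have "x \<otimes>\<^bsub>R\<^esub> y \<in> \<aa> (p + p')"
      using \<aa> p xy ideal_prod.prod[of x "\<aa> p" y "\<aa> p'" R] unfolding graded_family_def by blast
    then have "w (p + p') \<le> v (x \<otimes>\<^bsub>R\<^esub> y)" unfolding w_def ideal_value_def by (rule INF_lower)
    also have "\<dots> = w p + w p'"
      using val_mult ideal.Icarr[OF id[OF p(1)] xy(1)] ideal.Icarr[OF id[OF p(2)] xy(3)] xy by simp
    finally show ?thesis .
  qed
  define L where "L = (INF n\<in>{1..}. u n / real n)"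
  have "(\<lambda>n. u n / real n) \<longlonglongrightarrow> L"
    unfolding L_def
  proof (rule subadditive_limit)
    show "u n \<ge> 0" for n by (simp add: u_def)
    show "u (m + n) \<le> u m + u n" if "m \<ge> 1" "n \<ge> 1" for m n
    proof -
      have "ennreal (u (m + n)) \<le> ennreal (u m) + ennreal (u n)"
        using sub[OF that] wu[of m] wu[of n] wu[of "m + n"] that by simp
      then show ?thesis by (simp add: u_def flip: ennreal_plus)
    qed
  qed
  then have lim_u: "(\<lambda>n. ennreal (u n / real n)) \<longlonglongrightarrow> ennreal L" by (rule tendsto_ennrealI)
  have eq: "ennreal (u n / real n) = w n / of_nat n" if "n \<ge> 1" for n
  proof -
    have "u n \<ge> 0" by (simp add: u_def)
    then show ?thesis
      unfolding wu[OF that] using that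
      by (simp add: divide_ennreal ennreal_of_nat_eq_real_of_nat)
  qed
  have lim: "(\<lambda>n. w n / of_nat n) \<longlonglongrightarrow> ennreal L"
    by (rule Lim_transform_eventually[OF lim_u], rule eventually_sequentiallyI[of 1], rule eq)
  have "ennreal L = (INF n\<in>{1..}. w n / of_nat n)"
  proof (rule antisym)
    have "L \<le> u n / real n" if "n \<ge> 1" for n
      unfolding L_def using that
      by (intro cINF_lower bdd_belowI[of _ 0]) (auto simp: u_def)
    then show "ennreal L \<le> (INF n\<in>{1..}. w n / of_nat n)"
      by (intro INF_greatest) (simp flip: eq add: ennreal_leI)
    show "(INF n\<in>{1..}. w n / of_nat n) \<le> ennreal L"
      by (rule tendsto_lowerbound[OF lim])
        (auto intro!: eventually_sequentiallyI[of 1] INF_lower)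
  qed
  with lim show ?thesis by (simp add: asymptotic_value_def w_def)
qed

end

theory Submission
  imports Defs
begin

text \<open>If b_{qt} lies in the integral closure of a_{pt} for large t and x is in b_s, then x^{qt}
  lies in b_{qts}, hence in the integral closure of a_{pts}. Valuations do not drop under integral
  closure, so qt v(x) is at least pts v(a); dividing by qts and taking the infimum over x and s
  gives q v(b) \<ge> p v(a).\<close>

lemma (in ring) finsum_mem_ideal:
  assumes J: "ideal J R" and f: "\<And>i. i \<in> A \<Longrightarrow> f i \<in> J"
  shows "(\<Oplus>i\<in>A. f i) \<in> J"
proof -
  interpret J: ideal J R by fact
  show ?thesis
    using f
  \<comment> \<open>Over an infinite index set \<open>finsum\<close> is zero by convention, which
    lies in \<open>J\<close>.\<close>
  proof (induction A rule: infinite_finite_induct)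
    case (insert a A)
    then have "f a \<in> carrier R" "f \<in> A \<rightarrow> carrier R" by auto
    with insert show ?case by simp
  qed auto
qed

lemma (in ring) ideal_pow_is_ideal:
  assumes "ideal I R" shows "ideal (I [^]\<^bsub>ideals_set R\<^esub> (n::nat)) R"
  using assms by (induction n) (simp_all add: ideals_set_def oneideal ideal_prod_is_ideal)

text \<open>This includes the zero element with exponent 0: there the power is the unit, of value 0,
  and 0 times infinity is 0 in \<open>ennreal\<close>.\<close>

lemma (in valuation) val_pow:
  assumes "x \<in> carrier R" shows "v (x [^] (n::nat)) = of_nat n * v x"
  using assms by (induction n) (simp_all add: val_one val_mult distrib_right add.commute)

text \<open>A product ideal consists of sums of products \<open>i \<otimes> j\<close>. Inductively
  \<open>i\<close> has value at least n c and \<open>j\<close> at least c; the elements of value at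
  least (n + 1) c form an ideal, so the bound passes from products to sums.\<close>

lemma (in valuation) val_mem_ideal_pow:
  assumes I: "\<And>x. x \<in> I \<Longrightarrow> c \<le> v x" and "ideal I R"
    and "x \<in> I [^]\<^bsub>ideals_set R\<^esub> (n::nat)"
  shows "of_nat n * c \<le> v x"
  using assms(3)
proof (induction n arbitrary: x)
  case (Suc n)
  let ?J = "{y \<in> carrier R. of_nat (Suc n) * c \<le> v y}"
  have pow: "I [^]\<^bsub>ideals_set R\<^esub> n \<subseteq> carrier R"
    using ideal.Icarr[OF ideal_pow_is_ideal[OF \<open>ideal I R\<close>]] by blast
  interpret I: ideal I R by fact
  have "x \<in> (I [^]\<^bsub>ideals_set R\<^esub> n) \<cdot> I" using Suc.prems by (simp add: ideals_set_def)
  then have "x \<in> ?J"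
  proof (induction x rule: ideal_prod.induct)
    case (prod i j)
    then have "of_nat n * c + c \<le> v i + v j" using Suc.IH I by (intro add_mono)
    with prod show ?case using pow by (auto simp: val_mult algebra_simps)
  qed (rule additive_subgroup.a_closed[OF ideal.axioms(1)[OF ideal_val_ge]])
  then show ?case by simp
qed simp

text \<open>If v x < c for the value c of \<open>I\<close>, the i-th lower term of the integral
  equation has value at least i c + (n - i) v x. Replacing i - 1 copies of c by v x bounds this
  below by c + (n - 1) v x. Hence so is n v x, the value of the leading power, which forces c \<le>
  v x.\<close>

lemma (in valuation) ideal_value_le_integral_closure:
  assumes I: "ideal I R" and x: "x \<in> integral_closure R I"
  shows "ideal_value v I \<le> v x"
proof (rule ccontr)
  define c where "c = ideal_value v I"
  assume "\<not> ?thesis"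
  then have less: "v x < c" by (simp add: c_def)
  have xc: "x \<in> carrier R" using x by (simp add: integral_closure_def)
  obtain n :: nat and a where n: "n \<ge> 1"
    and a: "\<And>i. i \<in> {1..n} \<Longrightarrow> a i \<in> I [^]\<^bsub>ideals_set R\<^esub> i"
    and eq: "x [^] n \<oplus> (\<Oplus>i\<in>{1..n}. a i \<otimes> x [^] (n - i)) = \<zero>"
    using x unfolding integral_closure_def by blast
  \<comment> \<open>The bound obtained for i = 1, the weakest of all; since i \<ge> 1, each term
    keeps at least one factor c.\<close>
  define d where "d = c + of_nat (n - 1) * v x"
  have "a i \<otimes> x [^] (n - i) \<in> {y \<in> carrier R. d \<le> v y}" if i: "i \<in> {1..n}" for i
  proof -
    have ai: "a i \<in> carrier R" using ideal.Icarr[OF ideal_pow_is_ideal[OF I] a[OF i]] .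
    obtain j where j: "i = Suc j" using i by (cases i) auto
    have "of_nat i * c \<le> v (a i)"
      by (rule val_mem_ideal_pow[OF _ I a[OF i]]) (auto simp: c_def ideal_value_def INF_lower)
    have "n - 1 = j + (n - i)" using i j by auto
    then have "d = c + of_nat j * v x + of_nat (n - i) * v x"
      unfolding d_def by (simp add: distrib_right add.assoc)
    also have "\<dots> \<le> c + of_nat j * c + of_nat (n - i) * v x"
      using less by (intro add_mono mult_left_mono) auto
    also have "\<dots> = of_nat i * c + of_nat (n - i) * v x" by (simp add: j distrib_right)
    also have "\<dots> \<le> v (a i) + of_nat (n - i) * v x"
      using \<open>of_nat i * c \<le> v (a i)\<close> by (rule add_right_mono)
    also have "\<dots> = v (a i \<otimes> x [^] (n - i))" using ai xc by (simp add: val_mult val_pow)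
    finally show ?thesis using ai xc by simp
  qed
  then have s: "(\<Oplus>i\<in>{1..n}. a i \<otimes> x [^] (n - i)) \<in> {y \<in> carrier R. d \<le> v y}" (is "?s \<in> _")
    by (rule finsum_mem_ideal[OF ideal_val_ge])
  have "x [^] n = \<ominus> ?s" using eq s xc by (intro minus_equality[symmetric]) auto
  then have "d \<le> v (x [^] n)" using s by (simp add: val_uminus)
  also have "\<dots> = v x + of_nat (n - 1) * v x"
    using n xc by (cases n) (simp_all add: val_mult val_pow distrib_right)
  finally have "c + of_nat (n - 1) * v x \<le> v x + of_nat (n - 1) * v x" by (simp add: d_def)
  \<comment> \<open>Cancellation in \<open>ennreal\<close> needs a finite summand; v x is finite
    because it lies strictly below c.\<close>
  moreover have "of_nat (n - 1) * v x < \<infinity>" 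
    using order.strict_trans2[OF less top_greatest] by (simp add: ennreal_mult_less_top of_nat_less_top)
  ultimately have "c \<le> v x" by (auto simp: ennreal_add_left_cancel_le add.commute)
  with less show False by simp
qed

text \<open>The exponent is a successor because nothing is known about the member of the family at
  index 0.\<close>

lemma (in ring) graded_family_pow:
  assumes \<bb>: "graded_family R \<bb>" and "s \<ge> 1" and x: "x \<in> \<bb> s"
  shows "x [^] Suc n \<in> \<bb> (Suc n * s)"
proof (induction n)
  case 0
  have "ideal (\<bb> s) R" using assms by (simp add: graded_family_def)
  then have "x \<in> carrier R" using x by (rule ideal.Icarr)
  then show ?case using x by simp
next
  case (Suc n)
  have "x [^] Suc n \<otimes> x \<in> \<bb> (Suc n * s) \<cdot> \<bb> s" using Suc x by (rule ideal_prod.prod)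
  moreover have "Suc n * s \<ge> 1" using \<open>s \<ge> 1\<close> by simp
  ultimately have "x [^] Suc n \<otimes> x \<in> \<bb> (Suc n * s + s)"
    using \<bb> \<open>s \<ge> 1\<close> unfolding graded_family_def by blast
  then show ?case by (simp add: add.commute)
qed

lemma asymptotic_value_le:
  assumes "p \<ge> 1" shows "of_nat p * asymptotic_value v \<aa> \<le> ideal_value v (\<aa> p)"
proof -
  have "of_nat p * asymptotic_value v \<aa> \<le> of_nat p * (ideal_value v (\<aa> p) / of_nat p)"
    unfolding asymptotic_value_def using assms by (intro mult_left_mono INF_lower) auto
  also have "\<dots> = ideal_value v (\<aa> p)"
    using assms by (simp add: ennreal_times_divide mult.commute[of "of_nat p"] ennreal_mult_divide_eq)
  finally show ?thesis .
qed

text \<open>The divisor is positive and finite, so clearing it is an equivalence even for infinite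
  \<open>x\<close> or \<open>y\<close>.\<close>

lemma ennreal_le_divide_of_nat:
  fixes x y :: ennreal
  assumes "n \<ge> 1" shows "x \<le> y / of_nat n \<longleftrightarrow> of_nat n * x \<le> y"
proof -
  have n: "(of_nat n :: ennreal) \<noteq> 0" "(of_nat n :: ennreal) < \<infinity>" using assms by (auto simp: of_nat_less_top)
  have "x \<le> y / of_nat n \<longleftrightarrow> \<not> y < x * of_nat n"
    using divide_less_ennreal[of "of_nat n" y x] n by (simp add: not_less[symmetric])
  then show ?thesis by (simp add: not_less mult.commute)
qed

theorem theorem5p6:
  fixes R :: "('a, 'b) ring_scheme" and \<mm> :: "'a set" and \<aa> \<bb> :: "nat \<Rightarrow> 'a set"
  assumes "noetherian_local_domain R \<mm>"
    and "graded_family R \<aa>"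
    and "graded_family R \<bb>"
  shows "lojasiewicz_exponent R \<bb> \<aa> \<ge>
    (SUP v\<in>{v. centered_valuation R \<mm> v \<and> asymptotic_value v \<bb> > 0}.
       asymptotic_value v \<aa> / asymptotic_value v \<bb>)"
proof (rule SUP_least)
  fix v assume "v \<in> {v. centered_valuation R \<mm> v \<and> asymptotic_value v \<bb> > 0}"
  then have v: "valuation R v" and pos: "asymptotic_value v \<bb> > 0"
    by (auto simp: centered_valuation_def)
  interpret valuation R v by fact
  define \<alpha> where "\<alpha> = asymptotic_value v \<aa>"
  define \<beta> where "\<beta> = asymptotic_value v \<bb>"
  have "\<alpha> / \<beta> \<le> ennreal (real q / real p)"
    if p: "p \<ge> 1" and q: "q \<ge> 1"
      and ev: "\<forall>\<^sub>F t in sequentially. \<bb> (q * t) \<subseteq> integral_closure R (\<aa> (p * t))" for p q :: nat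
  proof -
    obtain T where T: "\<And>t. t \<ge> T \<Longrightarrow> \<bb> (q * t) \<subseteq> integral_closure R (\<aa> (p * t))"
      using ev by (auto simp: eventually_sequentially)
    have main: "of_nat s * (of_nat p * \<alpha>) \<le> of_nat q * v x" if s: "s \<ge> 1" and x: "x \<in> \<bb> s" for s x
    proof -
      have "ideal (\<bb> s) R" using assms(3) s by (simp add: graded_family_def)
      then have xc: "x \<in> carrier R" using x by (rule ideal.Icarr)
      \<comment> \<open>A multiple of s makes q t a multiple of s as well, so that a power of x
        lands in \<open>\<bb> (q * t)\<close>; the factor \<open>Suc T\<close> ensures both t \<ge>
        T and t \<ge> 1.\<close>
      define t where "t = Suc T * s"
      have "Suc T * 1 \<le> t" unfolding t_def using s by (rule mult_le_mono2)
      then have t: "t \<ge> T" "t \<ge> 1" by auto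
      define N where "N = q * Suc T"
      have N: "N \<ge> 1" using q by (simp add: N_def)
      have "x [^]\<^bsub>R\<^esub> N \<in> \<bb> (N * s)"
        using graded_family_pow[OF assms(3) s x, of "N - 1"] N by simp
      also have "N * s = q * t" by (simp only: N_def t_def mult.assoc)
      finally have "x [^]\<^bsub>R\<^esub> N \<in> integral_closure R (\<aa> (p * t))" using T[OF t(1)] by blast
      moreover have "ideal (\<aa> (p * t)) R"
        using assms(2) p t by (simp add: graded_family_def)
      ultimately have "ideal_value v (\<aa> (p * t)) \<le> v (x [^]\<^bsub>R\<^esub> N)"
        by (rule ideal_value_le_integral_closure[rotated])
      moreover have "of_nat (p * t) * \<alpha> \<le> ideal_value v (\<aa> (p * t))"
        unfolding \<alpha>_def using p t by (intro asymptotic_value_le) auto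
      ultimately have "of_nat (p * t) * \<alpha> \<le> of_nat N * v x" using xc by (simp add: val_pow)
      \<comment> \<open>The auxiliary threshold occurs on both sides as a positive finite factor and
        cancels.\<close>
      then have "of_nat (Suc T) * (of_nat s * (of_nat p * \<alpha>)) \<le> of_nat (Suc T) * (of_nat q * v x)"
        by (simp only: t_def N_def of_nat_mult mult.left_commute mult.commute mult.assoc)
      then show ?thesis by (subst (asm) ennreal_mult_le_mult_iff) (auto simp del: of_nat_Suc)
    qed
    have "of_nat p * \<alpha> / of_nat q \<le> \<beta>"
      unfolding \<beta>_def asymptotic_value_def ideal_value_def
    proof (intro INF_greatest)
      fix s :: nat assume "s \<in> {1..}"
      then have s: "s \<ge> 1" by simp
      have "of_nat s * (of_nat p * \<alpha> / of_nat q) \<le> v x" if "x \<in> \<bb> s" for x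
        unfolding ennreal_times_divide using main[OF s that] q
        by (intro divide_le_posI_ennreal) (auto simp: mult.commute)
      then show "of_nat p * \<alpha> / of_nat q \<le> (INF x\<in>\<bb> s. v x) / of_nat s"
        unfolding ennreal_le_divide_of_nat[OF s] by (rule INF_greatest)
    qed
    then have "of_nat p * \<alpha> / of_nat q * of_nat q \<le> \<beta> * of_nat q" by (rule mult_right_mono) simp
    then have "of_nat p * \<alpha> \<le> \<beta> * of_nat q"
      using q by (simp add: ennreal_divide_times of_nat_less_top)
    then have "\<alpha> \<le> \<beta> * of_nat q / of_nat p" using p by (simp add: ennreal_le_divide_of_nat)
    also have "\<dots> = \<beta> * (of_nat q / of_nat p)" by (simp add: ennreal_times_divide)
    also have "of_nat q / of_nat p = ennreal (real q / real p)"
      using p by (simp add: divide_ennreal ennreal_of_nat_eq_real_of_nat)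
    \<comment> \<open>Positivity of \<beta> is enough to divide: for infinite \<beta> the quotient
      is 0, even when \<alpha> is infinite.\<close>
    finally show ?thesis using pos by (intro divide_le_posI_ennreal) (auto simp: \<beta>_def)
  qed
  \<comment> \<open>If no pair p, q is admissible, the exponent is the infimum of the empty set,
    hence infinite, and the bound is vacuous.\<close>
  then show "\<alpha> / \<beta> \<le> lojasiewicz_exponent R \<bb> \<aa>" 
    unfolding lojasiewicz_exponent_def by (intro Inf_greatest) auto
qed

end
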